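(* Let $i,j$ be integers with $1\le i,j\le 6$, let $\alpha\in\{\frac12,1\}$, and put $c_{ij}=(-1)^i\,i^i\,j^j/(i+j)^{i+j}$. Let $\omega(t)$ be a period integral for a family of Weierstrass models $y^2=4x^3-g_2(t,u)x-g_3(t,u)$, with absolutely convergent series $\omega(t)=\sum_{k\ge0}f_kt^k$ for $|t|<1$, and suppose $0\le\deg_t(g_2)\le\min(\frac4i,\frac{4\alpha}{j})$ and $0<\deg_t(g_3)\le\min(\frac6i,\frac{6\alpha}{j})$. For the twisted family with generalized functional invariant $(i,j,\alpha)$, consider the period integral $$\tilde\omega(\tilde t)=\oint_{C}\frac{dv}{v(v+1)^\alpha}\;\omega\!\left(\frac{c_{ij}\tilde t}{v^i(v+1)^j}\right)$$ where $C=C_{1/2}(0)$ is the circle $|v|=\frac12$ with counterclockwise orientation. Then for every $\tilde t\in\mathbb{C}$ with $|\tilde t|<1/(2^{i+j+1}|c_{ij}|)$, $\tilde\omega(\tilde t)$ has an absolutely convergent series given by the Hadamard products: if $\alpha=1$, $$\tilde\omega(\tilde t)=(2\pi i)\;{}_{i+j-1}F_{i+j-2}\!\left(\tfrac{1}{i+j},\dots,\tfrac{i+j-1}{i+j};\ \tfrac1i,\dots,\tfrac{i-1}{i},\tfrac1j,\dots,\tfrac{j-1}{j}\,\Big|\,\tilde t\right)\star\omega(\tilde t),$$ and if $\alpha=\frac12$, $$\tilde\omega(\tilde t)=(2\pi i)\;{}_{i+j}F_{i+j-1}\!\left(\tfrac{\alpha}{i+j},\dots,\tfrac{\alpha+i+j-1}{i+j};\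 \tfrac1i,\dots,\tfrac{i-1}{i},\tfrac{\alpha}{j},\dots,\tfrac{\alpha+j-1}{j}\,\Big|\,\tilde t\right)\star\omega(\tilde t).$$ (In the prefactor $2\pi i$ the symbol $i$ denotes $\sqrt{-1}$.)
   Context: ${}_nF_{n-1}(\alpha_1,\dots,\alpha_n;\beta_1,\dots,\beta_{n-1}|t)=\sum_{k\ge0}\frac{(\alpha_1)_k\cdots(\alpha_n)_k}{(\beta_1)_k\cdots(\beta_{n-1})_k}\frac{t^k}{k!}$ with $(\alpha)_k=\Gamma(\alpha+k)/\Gamma(\alpha)$. The Hadamard product of $f=\sum f_nt^n$ and $g=\sum g_nt^n$ is $f\star g=\sum f_ng_nt^n$. The Weierstrass family $y^2=4x^3-g_2(t,u)x-g_3(t,u)$, $u=(u_1,\dots,u_{n-1})$, is a family (in $t\in\mathbb{P}^1\setminus\{0,1,\infty\}$) of minimal normal Weierstrass models of elliptically fibered Calabi-Yau $n$-folds with section; its period integrals are the integrals of $du_1\wedge\dots\wedge du_{n-1}\wedge dx/y$ over families of closed transcendental $n$-cycles that are locally parallel in $t$. The twisted family with generalized functional invariant $(i,j,\alpha)$ is the family of $(n+1)$-folds $$\tilde y^2=4\tilde x^3-g_2\!\left(\tfrac{c_{ij}\tilde t}{v^i(v+1)^j},u\right)v^4(v+1)^{4\alpha}\tilde x-g_3\!\left(\tfrac{c_{ij}\tilde t}{v^i(v+1)^j},u\right)v^6(v+1)^{6\alpha}$$ (affine chart of the base $\mathbb{P}^1\times S\ni(v,u)$), with holomorphic form $dv\wedge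 du_1\wedge\dots\wedge du_{n-1}\wedge d\tilde x/\tilde y$. With $\tilde x=v^2(v+1)^{2\alpha}x$ and $\tilde y=v^3(v+1)^{3\alpha}y$ this form equals $\frac{dv}{v(v+1)^\alpha}\wedge du_1\wedge\dots\wedge du_{n-1}\wedge\frac{dx}{y}$, so integration over a loop $C$ in the $v$-plane gives the displayed period integral. On $|v|=\frac12$ the function $(v+1)^{\alpha}$ is the principal branch. *)

theory Defs
  imports
    "HOL-Complex_Analysis.Complex_Analysis"
    "HOL-Homology.Homology"
    "Jordan_Normal_Form.Determinant"
begin

section \<open>Holomorphic functions of several variables and compact complex manifolds\<close>

text \<open>The dimension is a natural number that may be 0 (the base of a family of elliptic curves is
  a point), so \<open>\<complex>\<^sup>m\<close> is the product topology on extensional functions on \<open>{..<m}\<close>.\<close>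

abbreviation cspace :: "nat \<Rightarrow> (nat \<Rightarrow> complex) topology" where
  "cspace m \<equiv> product_topology (\<lambda>_. euclidean) {..<m}"

definition holo :: "nat \<Rightarrow> (nat \<Rightarrow> complex) set \<Rightarrow> ((nat \<Rightarrow> complex) \<Rightarrow> complex) \<Rightarrow> bool" where
  "holo m V h \<longleftrightarrow>
     openin (cspace m) V \<and> continuous_map (subtopology (cspace m) V) euclidean h \<and>
     (\<forall>p\<in>V. \<forall>k<m. (\<lambda>z. h (p(k := z))) field_differentiable (at (p k)))"

definition jac :: "nat \<Rightarrow> ((nat \<Rightarrow> complex) \<Rightarrow> (nat \<Rightarrow> complex)) \<Rightarrow> (nat \<Rightarrow> complex) \<Rightarrow> complex" where
  "jac m \<tau> p =
     Determinant.det (Matrix.mat m m (\<lambda>(a, b). deriv (\<lambda>z. \<tau> (p(b := z)) a) (p b)))"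

type_synonym 's chart = "'s set \<times> ('s \<Rightarrow> nat \<Rightarrow> complex)"

definition holo_atlas :: "nat \<Rightarrow> 's topology \<Rightarrow> 's chart set \<Rightarrow> bool" where
  "holo_atlas m S A \<longleftrightarrow>
     (\<Union>(U, \<phi>)\<in>A. U) = topspace S \<and>
     (\<forall>(U, \<phi>)\<in>A. openin S U \<and> openin (cspace m) (\<phi> ` U) \<and>
        homeomorphic_map (subtopology S U) (subtopology (cspace m) (\<phi> ` U)) \<phi>) \<and>
     (\<forall>(U, \<phi>)\<in>A. \<forall>(U', \<phi>')\<in>A. \<forall>k<m.
        holo m (\<phi> ` (U \<inter> U')) (\<lambda>w. \<phi>' (inv_into U \<phi> w) k))"

definition compact_complex_manifold :: "nat \<Rightarrow> 's topology \<Rightarrow> 's chart set \<Rightarrow> bool" where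
  "compact_complex_manifold m S A \<longleftrightarrow>
     topspace S \<noteq> {} \<and> compact_space S \<and> connected_space S \<and> Hausdorff_space S \<and> holo_atlas m S A"


section \<open>Weierstrass families of elliptically fibered Calabi-Yau varieties\<close>

text \<open>\<open>h\<close> is the local expression, in the chart \<open>(U', \<phi>)\<close> with coordinates \<open>w\<close>, of the section
  \<open>g(u) (du\<^sub>1 \<and> \<dots> \<and> du\<^sub>m)\<^bsup>-r\<^esup>\<close> of the line bundle \<open>K\<^sub>S\<^bsup>-r\<^esup>\<close> given on the chart \<open>(U, u)\<close>.  Since
  \<open>du = jac dw\<close>, one has \<open>g = h jac\<^sup>r\<close> on the overlap.\<close>

definition local_expr ::
  "nat \<Rightarrow> 's chart \<Rightarrow> nat \<Rightarrow> ((nat \<Rightarrow> complex) \<Rightarrow> complex) \<Rightarrow> 's chart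
     \<Rightarrow> ((nat \<Rightarrow> complex) \<Rightarrow> complex) \<Rightarrow> bool" where
  "local_expr m c r g c' h \<longleftrightarrow>
     (case c of (U, u) \<Rightarrow> case c' of (U', \<phi>) \<Rightarrow>
        holo m (\<phi> ` U') h \<and>
        (\<forall>w \<in> \<phi> ` (U \<inter> U').
           g (u (inv_into U' \<phi> w)) = h w * jac m (\<lambda>w. u (inv_into U' \<phi> w)) w ^ r))"

text \<open>Minimality: there is no prime divisor of \<open>S\<close> along which \<open>h2\<close> vanishes to order at least 4
  and \<open>h3\<close> to order at least 6; this is local on the base.\<close>

definition minimal_at ::
  "nat \<Rightarrow> (nat \<Rightarrow> complex) set \<Rightarrow> ((nat \<Rightarrow> complex) \<Rightarrow> complex) \<Rightarrow> ((nat \<Rightarrow> complex) \<Rightarrow> complex)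
     \<Rightarrow> (nat \<Rightarrow> complex) \<Rightarrow> bool" where
  "minimal_at m V h2 h3 p \<longleftrightarrow>
     (\<nexists>N q a b. p \<in> N \<and> N \<subseteq> V \<and> holo m N q \<and> holo m N a \<and> holo m N b \<and> q p = 0 \<and>
        (\<forall>w\<in>N. h2 w = q w ^ 4 * a w \<and> h3 w = q w ^ 6 * b w))"

text \<open>The Weierstrass coefficients are polynomials in \<open>t\<close> whose coefficients are functions of the
  affine coordinates \<open>u\<close>: \<open>g\<^sub>2(t, u) = poly (g2 u) t\<close>.  They matter only for \<open>u\<close> in the image
  of the distinguished chart.\<close>

type_synonym wcoeff = "(nat \<Rightarrow> complex) \<Rightarrow> complex poly"

definition deg_t :: "(nat \<Rightarrow> complex) set \<Rightarrow> wcoeff \<Rightarrow> nat" where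
  "deg_t V g = (SUP u\<in>V. degree (g u))"

text \<open>A family, over \<open>t \<in> \<complex> - {0, 1}\<close>, of minimal normal Weierstrass models of elliptically fibered
  Calabi-Yau \<open>n\<close>-folds with section over the compact complex manifold \<open>S\<close> of dimension \<open>n - 1\<close>.
  The canonical bundle of the Weierstrass model with fundamental line bundle \<open>L\<close> is the pullback of
  \<open>K\<^sub>S \<otimes> L\<close>, so the Calabi-Yau condition is \<open>L = K\<^sub>S\<^bsup>-1\<^esup>\<close>: \<open>g\<^sub>2\<close> and \<open>g\<^sub>3\<close> are sections of
  \<open>K\<^sub>S\<^bsup>-4\<^esup>\<close> and \<open>K\<^sub>S\<^bsup>-6\<^esup>\<close>.  The generic fiber is smooth iff the discriminant does not vanish
  identically; over a smooth base such a Weierstrass model is normal.  The section is the point at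
  infinity of each fiber.\<close>

definition weierstrass_CY_family ::
  "nat \<Rightarrow> 's topology \<Rightarrow> 's chart set \<Rightarrow> 's chart \<Rightarrow> wcoeff \<Rightarrow> wcoeff \<Rightarrow> bool" where
  "weierstrass_CY_family n S A c g2 g3 \<longleftrightarrow>
     compact_complex_manifold (n - 1) S A \<and> c \<in> A \<and>
     S closure_of (fst c) = topspace S \<and>
     (\<forall>g\<in>{g2, g3}. bdd_above ((\<lambda>u. degree (g u)) ` (snd c ` fst c))) \<and>
     (\<forall>t. t \<noteq> 0 \<longrightarrow> t \<noteq> 1 \<longrightarrow>
        (\<exists>u \<in> snd c ` fst c. poly (g2 u) t ^ 3 - 27 * poly (g3 u) t ^ 2 \<noteq> 0) \<and>
        (\<forall>c'\<in>A. \<exists>h2 h3.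
           local_expr (n - 1) c 4 (\<lambda>u. poly (g2 u) t) c' h2 \<and>
           local_expr (n - 1) c 6 (\<lambda>u. poly (g3 u) t) c' h3 \<and>
           (\<forall>p \<in> snd c' ` fst c'. minimal_at (n - 1) (snd c' ` fst c') h2 h3 p)))"


section \<open>Period integrals\<close>

text \<open>The smooth locus of the affine chart over \<open>V\<close> of the Weierstrass model at \<open>t\<close>, that is, the
  model minus the zero section, the fibers over the complement of the chart, and the singular
  points.  A point of \<open>\<complex>\<^bsup>n+1\<^esup>\<close> has coordinates \<open>u\<^sub>1, \<dots>, u\<^bsub>n-1\<^esub>, x, y\<close> at the indices
  \<open>0, \<dots>, n - 2, n - 1, n\<close>.\<close>

definition wmodel ::
  "nat \<Rightarrow> (nat \<Rightarrow> complex) set \<Rightarrow> wcoeff \<Rightarrow> wcoeff \<Rightarrow> complex \<Rightarrow> (nat \<Rightarrow> complex) set" where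
  "wmodel n V g2 g3 t =
     {p \<in> topspace (cspace (n + 1)).
        let u = restrict p {..<n - 1}; x = p (n - 1); y = p n in
          u \<in> V \<and>
          y\<^sup>2 = 4 * x ^ 3 - poly (g2 u) t * x - poly (g3 u) t \<and>
          (2 * y \<noteq> 0 \<or> 12 * x\<^sup>2 - poly (g2 u) t \<noteq> 0 \<or>
           (\<exists>k<n - 1.
              deriv (\<lambda>z. poly (g2 (u(k := z))) t * x + poly (g3 (u(k := z))) t) (u k) \<noteq> 0))}"

text \<open>Coordinates \<open>s\<^sub>1, \<dots>, s\<^sub>n\<close> on the standard \<open>n\<close>-simplex.\<close>

definition bary :: "nat \<Rightarrow> (nat \<Rightarrow> real) \<Rightarrow> (nat \<Rightarrow> real)" where
  "bary n s = (\<lambda>k. if k = 0 then 1 - (\<Sum>l=1..n. s l) else if k \<le> n then s k else 0)"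

definition smooth_simplex :: "nat \<Rightarrow> ((nat \<Rightarrow> real) \<Rightarrow> (nat \<Rightarrow> complex)) \<Rightarrow> bool" where
  "smooth_simplex n \<sigma> \<longleftrightarrow>
     (\<exists>G :: (nat \<Rightarrow> real) \<Rightarrow> nat \<Rightarrow> complex.
        (\<forall>a\<le>n. \<forall>k\<in>{1..n}. \<exists>D. continuous_on UNIV D \<and>
           (\<forall>s. ((\<lambda>r. G (s(k := r)) a) has_vector_derivative D s) (at (s k)))) \<and>
        (\<forall>s. bary n s \<in> standard_simplex n \<longrightarrow> (\<forall>a\<le>n. \<sigma> (bary n s) a = G s a)))"

text \<open>The integral of \<open>du\<^sub>1 \<and> \<dots> \<and> du\<^bsub>n-1\<^esub> \<and> dx / y\<close> over a smooth singular simplex.  On the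
  smooth locus the form is holomorphic and equals \<open>2 du \<and> dy / (12 x\<^sup>2 - g\<^sub>2)\<close> (or a similar
  expression with \<open>dy\<close>) near \<open>y = 0\<close>, so its pullback vanishes almost everywhere on \<open>y = 0\<close>, in
  agreement with \<open>z / 0 = 0\<close>.\<close>

definition simplex_integral :: "nat \<Rightarrow> ((nat \<Rightarrow> real) \<Rightarrow> (nat \<Rightarrow> complex)) \<Rightarrow> complex" where
  "simplex_integral n \<sigma> =
     (let M = PiM {1..n} (\<lambda>_. lborel) in
      LINT s : {s \<in> space M. bary n s \<in> standard_simplex n} | M.
        Determinant.det (Matrix.mat n n (\<lambda>(a, b).
          vector_derivative (\<lambda>r. \<sigma> (bary n (s(Suc b := r))) a) (at (s (Suc b)))))
        / \<sigma> (bary n s) n)"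

definition chain_integral :: "nat \<Rightarrow> (nat \<Rightarrow> complex) chain \<Rightarrow> complex" where
  "chain_integral n c =
     (\<Sum>\<sigma> \<in> Poly_Mapping.keys c. of_int (Poly_Mapping.lookup c \<sigma>) * simplex_integral n \<sigma>)"

text \<open>A family of closed \<open>n\<close>-cycles on the fibers over \<open>D\<close>, locally parallel in \<open>t\<close>: locally the
  cycles are homologous in the total space of the family over a disc.  Transcendental cycles are
  those that can be moved off the divisors, here off the complement of \<open>wmodel\<close>.\<close>

definition parallel_cycles ::
  "nat \<Rightarrow> (nat \<Rightarrow> complex) set \<Rightarrow> wcoeff \<Rightarrow> wcoeff \<Rightarrow> complex set
     \<Rightarrow> (complex \<Rightarrow> (nat \<Rightarrow> complex) chain) \<Rightarrow> bool" where
  "parallel_cycles n V g2 g3 D \<Sigma> \<longleftrightarrow>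
     (\<forall>t\<in>D. singular_relcycle n (subtopology (cspace (n + 1)) (wmodel n V g2 g3 t)) {} (\<Sigma> t) \<and>
        (\<forall>\<sigma> \<in> Poly_Mapping.keys (\<Sigma> t). smooth_simplex n \<sigma>)) \<and>
     (\<forall>t0\<in>D. \<exists>\<epsilon>>0. ball t0 \<epsilon> \<subseteq> D \<and>
        (\<forall>t\<in>ball t0 \<epsilon>.
           homologous_rel n
             (subtopology (prod_topology euclidean (cspace (n + 1)))
                (SIGMA t:ball t0 \<epsilon>. wmodel n V g2 g3 t)) {}
             (chain_map n (Pair t) (\<Sigma> t)) (chain_map n (Pair t0) (\<Sigma> t0))))"

text \<open>The fiber at \<open>t = 0\<close> may be singular, so a period integral on the unit disc is a period of the
  fibers over the punctured disc.\<close>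

definition period_integral ::
  "nat \<Rightarrow> (nat \<Rightarrow> complex) set \<Rightarrow> wcoeff \<Rightarrow> wcoeff \<Rightarrow> (complex \<Rightarrow> complex) \<Rightarrow> bool" where
  "period_integral n V g2 g3 \<omega> \<longleftrightarrow>
     (\<exists>\<Sigma>. parallel_cycles n V g2 g3 (ball 0 1 - {0}) \<Sigma> \<and>
        (\<forall>t \<in> ball 0 1 - {0}. \<omega> t = chain_integral n (\<Sigma> t)))"


section \<open>The twisted family\<close>

definition twist_const :: "nat \<Rightarrow> nat \<Rightarrow> real" where
  "twist_const i j = (- 1) ^ i * real i ^ i * real j ^ j / real (i + j) ^ (i + j)"

text \<open>In the coordinates \<open>\<tilde>x = v\<^sup>2 (v + 1)\<^bsup>2\<alpha>\<^esup> x\<close>, \<open>\<tilde>y = v\<^sup>3 (v + 1)\<^bsup>3\<alpha>\<^esup> y\<close> of the twisted family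
  with generalized functional invariant \<open>(i, j, \<alpha>)\<close>, the form \<open>dv \<and> du \<and> d\<tilde>x / \<tilde>y\<close> is
  \<open>dv / (v (v + 1)\<^sup>\<alpha>) \<and> du \<and> dx / y\<close>, and the fiber over \<open>v\<close> is the Weierstrass model at
  \<open>c\<^bsub>ij\<^esub> t / (v\<^sup>i (v + 1)\<^sup>j)\<close>.  The following is the period of this form after integration along
  the fiber cycles.\<close>

definition twisted_integrand ::
  "nat \<Rightarrow> nat \<Rightarrow> real \<Rightarrow> (complex \<Rightarrow> complex) \<Rightarrow> complex \<Rightarrow> complex \<Rightarrow> complex" where
  "twisted_integrand i j \<alpha> \<omega> t v =
     1 / (v * (v + 1) powr of_real \<alpha>) * \<omega> (of_real (twist_const i j) * t / (v ^ i * (v + 1) ^ j))"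

definition fps_hadamard :: "'a::times fps \<Rightarrow> 'a fps \<Rightarrow> 'a fps" (infixl \<open>\<star>\<close> 70) where
  "f \<star> g = Abs_fps (\<lambda>k. fps_nth f k * fps_nth g k)"

definition has_abs_series :: "(complex \<Rightarrow> complex) \<Rightarrow> complex fps \<Rightarrow> complex set \<Rightarrow> bool" where
  "has_abs_series \<omega> f D \<longleftrightarrow>
     (\<forall>t\<in>D. summable (\<lambda>k. norm (fps_nth f k * t ^ k)) \<and> \<omega> t = eval_fps f t)"

end

theory Submission
  imports Defs
begin

text \<open>On \<open>|v| = 1/2\<close> both \<open>|v|\<close> and \<open>|v + 1|\<close> are at least \<open>1/2\<close>, so for \<open>t\<close> in the given disc the
  argument of \<open>\<omega>\<close> has modulus at most \<open>1/2\<close> and the series may be integrated term by term.  The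
  \<open>k\<close>-th term is the integral of \<open>v\<^bsup>-1-ik\<^esup> (1 + v)\<^bsup>-\<alpha>-jk\<^esup>\<close>, a generalised binomial coefficient,
  and Gauss's multiplication formula for Pochhammer symbols turns it into a hypergeometric
  coefficient; the powers of \<open>i\<close>, \<open>j\<close> and \<open>i + j\<close> that arise are absorbed by \<open>c\<^bsub>ij\<^esub>\<^sup>k\<close>.\<close>

section \<open>Pochhammer symbols and the twisted binomial coefficient\<close>

text \<open>Sort the factors of the left side by their index modulo \<open>n\<close>: raising
  \<open>k\<close> by one adds \<open>n\<close> consecutive factors, one to each residue class, and
  each is \<open>n\<close> times the new factor of its symbol on the right.\<close>

lemma pochhammer_mult_arg:
  fixes a :: "'a::field_char_0"
  assumes "n > 0"
  shows "pochhammer a (n * k) =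
    of_nat n ^ (n * k) * (\<Prod>r<n. pochhammer ((a + of_nat r) / of_nat n) k)"
proof (induction k)
  case (Suc k)
  have "a + of_nat (n * k) + of_nat r = of_nat n * ((a + of_nat r) / of_nat n + of_nat k)" for r
    using assms by (simp add: field_simps)
  then have "pochhammer (a + of_nat (n * k)) n =
      of_nat n ^ n * (\<Prod>r<n. (a + of_nat r) / of_nat n + of_nat k)"
    by (simp add: pochhammer_prod atLeast0LessThan prod.distrib)
  moreover have "pochhammer a (n * Suc k) = pochhammer a (n * k) * pochhammer (a + of_nat (n * k)) n"
    using pochhammer_product'[of a "n * k" n] by (simp add: add.commute)
  ultimately show ?case
    unfolding Suc.IH pochhammer_Suc prod.distrib mult_Suc_right power_add
    by (simp only: mult_ac)
qed simp

lemma pochhammer_of_real_pos_nonzero: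
  assumes "0 < x"
  shows "pochhammer (of_real x :: complex) k \<noteq> 0"
  using pochhammer_pos[OF assms, of k] by (simp add: pochhammer_of_real)

lemma twist_const_nonzero: "0 < i \<Longrightarrow> 0 < j \<Longrightarrow> twist_const i j \<noteq> 0"
  by (simp add: twist_const_def)

text \<open>The hypergeometric coefficient before any cancellation, so that one formula covers both
  values of \<alpha>.\<close>

definition twist_coeff :: "nat \<Rightarrow> nat \<Rightarrow> complex \<Rightarrow> nat \<Rightarrow> complex" where
  "twist_coeff i j a k =
     (\<Prod>r<i + j. pochhammer ((a + of_nat r) / of_nat (i + j)) k) /
     ((\<Prod>r<i. pochhammer ((1 + of_nat r) / of_nat i) k) *
      (\<Prod>r<j. pochhammer ((a + of_nat r) / of_nat j) k))"

text \<open>Up to sign the binomial is \<open>X / fact (i * k)\<close>, and \<open>X\<close> is a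
  quotient of two Pochhammer symbols at \<alpha>, of lengths \<open>(i + j) * k\<close> and
  \<open>j * k\<close>. The multiplication formula applies to these two and to the
  factorial.\<close>

lemma twist_const_power_gbinomial:
  assumes "0 < i" "0 < j" "0 < (\<alpha>::real)"
  shows "of_real (twist_const i j) ^ k * (- (of_real \<alpha> + of_nat (j * k)) gchoose (i * k)) =
    twist_coeff i j (of_real \<alpha>) k"
proof -
  define P where "P n a = (\<Prod>r<n. pochhammer ((a + of_nat r) / of_nat n :: complex) k)" for n a
  define X where "X = pochhammer (of_real \<alpha> + of_nat (j * k) :: complex) (i * k)"
  have fact: "fact (i * k) = of_nat i ^ (i * k) * P i 1"
    using pochhammer_mult_arg[OF \<open>0 < i\<close>, of "1::complex" k] by (simp add: pochhammer_fact P_def)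
  have "pochhammer (of_real \<alpha> :: complex) ((i + j) * k) = pochhammer (of_real \<alpha>) (j * k) * X"
    using pochhammer_product'[of "of_real \<alpha> :: complex" "j * k" "i * k"]
    by (simp add: X_def algebra_simps)
  then have prod: "of_nat (i + j) ^ ((i + j) * k) * P (i + j) (of_real \<alpha>) =
      of_nat j ^ (j * k) * P j (of_real \<alpha>) * X"
    using assms pochhammer_mult_arg[of "i + j" "of_real \<alpha> :: complex" k]
      pochhammer_mult_arg[of j "of_real \<alpha> :: complex" k] by (simp add: P_def)
  \<comment> \<open>Since \<alpha> is positive, all these parameters are positive reals.\<close>
  have "pochhammer ((of_real \<alpha> + of_nat r) / of_nat j :: complex) k \<noteq> 0" for r
    using pochhammer_of_real_pos_nonzero[of "(\<alpha> + real r) / real j" k] assms by simp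
  then have Pj: "P j (of_real \<alpha>) \<noteq> 0"
    by (simp add: P_def)
  have Pi: "P i 1 \<noteq> 0"
    using fact by (metis fact_nonzero mult_zero_right)
  \<comment> \<open>The sign in \<open>twist_const\<close> cancels the sign of the binomial with
    negative upper argument.\<close>
  have c: "of_real (twist_const i j) ^ k * (-1) ^ (i * k) =
      of_nat i ^ (i * k) * of_nat j ^ (j * k) / (of_nat (i + j) ^ ((i + j) * k) :: complex)"
    by (simp add: twist_const_def power_divide power_mult_distrib flip: power_mult)
  have "of_real (twist_const i j) ^ k * (- (of_real \<alpha> + of_nat (j * k)) gchoose (i * k)) =
      of_real (twist_const i j) ^ k * (-1) ^ (i * k) * X / (of_nat i ^ (i * k) * P i 1)"
    unfolding gbinomial_pochhammer minus_minus fact X_def by (simp only: mult.assoc times_divide_eq_right)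
  also have "\<dots> = P (i + j) (of_real \<alpha>) / (P i 1 * P j (of_real \<alpha>))"
    \<comment> \<open>\<open>of_nat_neq_0\<close> speaks of a successor; at \<open>i + j - 1\<close>
      it says that \<open>i + j\<close> is nonzero.\<close>
    unfolding c using prod Pi Pj assms of_nat_neq_0[of "i + j - 1", where 'a = complex]
    by (simp add: field_simps)
  finally show ?thesis
    by (simp add: P_def twist_coeff_def)
qed

section \<open>Coefficients of the hypergeometric series\<close>

lemma foldl_mult_eq_prod_list:
  fixes p :: "'b \<Rightarrow> 'a::comm_monoid_mult"
  shows "foldl (\<lambda>r x. r * p x) z xs = z * prod_list (map p xs)"
  by (induction xs arbitrary: z) (simp_all add: mult_ac)

lemma prod_list_upt_eq_prod: "prod_list (map p [0..<n]) = (\<Prod>r<n. p r)"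
  by (simp add: atLeast0LessThan flip: prod.distinct_set_conv_list)

text \<open>The last factor is \<open>(1)\<^sub>k = k!\<close>, which the upper and lower parameter lists of the
  hypergeometric series omit.\<close>

lemma prod_pochhammer_1:
  assumes "0 < n"
  shows "(\<Prod>r<n. pochhammer ((1 + of_nat r) / of_nat n) k) =
    prod_list (map (\<lambda>r. pochhammer (of_nat r / of_nat n) k) [1..<n]) *
      (fact k :: 'a::field_char_0)"
proof -
  obtain m where n: "n = Suc m"
    using assms by (cases n) auto
  have "prod_list (map (\<lambda>r. pochhammer (of_nat r / of_nat n :: 'a) k) [1..<n]) =
      prod_list (map (\<lambda>r. pochhammer ((1 + of_nat r) / of_nat n) k) [0..<m])"
    unfolding n One_nat_def map_Suc_upt[symmetric] by (simp add: comp_def)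
  moreover have "pochhammer ((1 + of_nat m) / of_nat n :: 'a) k = fact k"
    by (simp add: n pochhammer_fact del: of_nat_Suc flip: of_nat_Suc)
  ultimately show ?thesis
    by (simp add: n prod_list_upt_eq_prod)
qed

text \<open>The last factor of the product over \<open>r < i\<close> is the \<open>k!\<close> that
  divides the \<open>k\<close>-th term of every hypergeometric series.\<close>

lemma fps_hypergeo_nth_eq_twist_coeff:
  assumes "0 < i" "0 < j"
  shows "fps_nth (fps_hypergeo
      (map (\<lambda>r. (a + of_nat r) / of_nat (i + j)) [0..<i + j])
      (map (\<lambda>r. of_nat r / of_nat i) [1..<i] @
       map (\<lambda>r. (a + of_nat r) / of_nat j) [0..<j]) 1) k = twist_coeff i j a k"
  using assms
  by (simp add: twist_coeff_def foldl_mult_eq_prod_list prod_pochhammer_1 comp_def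
      prod_list_upt_eq_prod mult_ac del: of_nat_add upt_Suc)

text \<open>For \<open>a = 1\<close> each of the three products in \<open>twist_coeff\<close>
  contains \<open>k!\<close>. One pair cancels, which removes an upper and a lower parameter; the
  other \<open>k!\<close> below is that of the series.\<close>

lemma fps_hypergeo_nth_eq_twist_coeff_1:
  assumes "0 < i" "0 < j"
  shows "fps_nth (fps_hypergeo
      (map (\<lambda>r. of_nat r / of_nat (i + j)) [1..<i + j])
      (map (\<lambda>r. of_nat r / of_nat i) [1..<i] @
       map (\<lambda>r. of_nat r / of_nat j) [1..<j]) 1) k = twist_coeff i j 1 k"
  using assms
  by (simp add: twist_coeff_def foldl_mult_eq_prod_list prod_pochhammer_1 comp_def
      del: of_nat_add upt_Suc)

section \<open>The integral of one term and bounds on the circle\<close>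

text \<open>Cauchy's formula for the \<open>m\<close>-th derivative at 0, whose value is read off
  the binomial series.\<close>

lemma has_contour_integral_one_plus_powr:
  assumes "0 < r" "r < 1"
  shows "((\<lambda>v. (1 + v) powr a / v ^ Suc m) has_contour_integral
    2 * of_real pi * \<i> * (a gchoose m)) (circlepath 0 r)"
proof -
  \<comment> \<open>As \<open>r < 1\<close>, the real part of \<open>1 + v\<close> is positive, away
    from the branch cut.\<close>
  have "1 + v \<notin> \<real>\<^sub>\<le>\<^sub>0" if "v \<in> cball 0 r" for v :: complex
    using that abs_Re_le_cmod[of v] assms by (auto simp: complex_nonpos_Reals_iff)
  then have hol: "(\<lambda>v. (1 + v) powr a) holomorphic_on cball 0 r"
    by (intro holomorphic_intros) auto
  have "(deriv ^^ m) (\<lambda>v. (1 + v) powr a) 0 = fact m * (a gchoose m)"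
    using fps_nth_fps_expansion[OF has_fps_expansion_binomial_complex[of a], of m]
    by (simp add: field_simps)
  moreover have "((\<lambda>v. (1 + v) powr a / (v - 0) ^ Suc m) has_contour_integral
      2 * of_real pi * \<i> / fact m * (deriv ^^ m) (\<lambda>v. (1 + v) powr a) 0) (circlepath 0 r)"
    using Cauchy_has_contour_integral_higher_derivative_circlepath[of 0 r "\<lambda>v. (1 + v) powr a" 0 m]
      assms holomorphic_on_imp_continuous_on[OF hol] holomorphic_on_subset[OF hol ball_subset_cball]
    by simp
  ultimately show ?thesis
    by (simp add: mult.assoc)
qed

lemma half_le_norm_add_1:
  fixes v :: complex
  assumes "norm v = 1/2"
  shows "1/2 \<le> norm (v + 1)"
  using norm_triangle_ineq4[of "v + 1" v] assms by simp

text \<open>The denominator has modulus at least \<open>(1/2) ^ (i + j)\<close>. The further factor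
  2 in the radius of the disc keeps the argument in a compact part of the unit disc, as uniform
  convergence requires.\<close>

lemma norm_twist_arg_le:
  fixes v t :: complex
  assumes "norm v = 1/2" "0 < i" "0 < j"
    and "t \<in> ball 0 (1 / (2 ^ (i + j + 1) * \<bar>twist_const i j\<bar>))"
  shows "norm (of_real (twist_const i j) * t / (v ^ i * (v + 1) ^ j)) \<le> 1/2"
proof -
  have "(1/2) ^ (i + j) \<le> norm (v ^ i * (v + 1) ^ j)"
    using power_mono[OF half_le_norm_add_1[OF assms(1)], of j]
    by (simp add: norm_mult norm_power power_add assms(1))
  then have "norm (of_real (twist_const i j) * t / (v ^ i * (v + 1) ^ j)) \<le>
      \<bar>twist_const i j\<bar> * norm t / (1/2) ^ (i + j)"
    unfolding norm_divide by (intro frac_le) (auto simp: norm_mult)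
  also have "\<dots> \<le> 1/2"
    using assms twist_const_nonzero[of i j] by (simp add: field_simps)
  finally show ?thesis .
qed

lemma norm_twist_form_le:
  fixes v :: complex
  assumes "norm v = 1/2" "0 < \<alpha>"
  shows "norm (1 / (v * (v + 1) powr of_real \<alpha>)) \<le> 2 * 2 powr \<alpha>"
proof -
  have "(1/2) powr \<alpha> \<le> norm (v + 1) powr \<alpha>"
    using half_le_norm_add_1[OF assms(1)] assms by (intro powr_mono2) auto
  then have "1 / norm ((v + 1) powr of_real \<alpha>) \<le> 1 / (1/2) powr \<alpha>"
    by (intro frac_le) (auto simp: norm_powr_real_powr')
  then have "2 * (1 / norm ((v + 1) powr of_real \<alpha>)) \<le> 2 * 2 powr \<alpha>"
    by (simp add: powr_divide)
  then show ?thesis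
    unfolding norm_divide norm_mult assms(1) by simp
qed

text \<open>On the circle the integrand is a constant times
  \<open>(1 + v) powr ?a / v ^ Suc (i * k)\<close>, to which the binomial integral applies with
  \<open>m = i * k\<close>.\<close>

lemma has_contour_integral_twisted_term:
  assumes "0 < i" "0 < j" "0 < \<alpha>"
  shows "((\<lambda>v. 1 / (v * (v + 1) powr of_real \<alpha>) *
        (b * (of_real (twist_const i j) * t / (v ^ i * (v + 1) ^ j)) ^ k))
      has_contour_integral 2 * of_real pi * \<i> * (twist_coeff i j (of_real \<alpha>) k * b) * t ^ k)
      (circlepath 0 (1/2))"
proof -
  let ?a = "- (of_real \<alpha> + of_nat (j * k)) :: complex"
  let ?c = "of_real (twist_const i j) :: complex"
  have "((\<lambda>v. b * (?c * t) ^ k * ((1 + v) powr ?a / v ^ Suc (i * k))) has_contour_integral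
      b * (?c * t) ^ k * (2 * of_real pi * \<i> * (?a gchoose (i * k)))) (circlepath 0 (1/2))"
    by (intro has_contour_integral_lmul has_contour_integral_one_plus_powr) auto
  also have "b * (?c * t) ^ k * (2 * of_real pi * \<i> * (?a gchoose (i * k))) =
      2 * of_real pi * \<i> * (twist_coeff i j (of_real \<alpha>) k * b) * t ^ k"
    by (simp add: power_mult_distrib mult_ac flip: twist_const_power_gbinomial[OF assms])
  finally show ?thesis
  proof (rule has_contour_integral_eq)
    fix v assume "v \<in> path_image (circlepath 0 (1/2) :: real \<Rightarrow> complex)"
    then have v: "norm v = 1/2" by simp
    then have nz: "v \<noteq> 0" "v + 1 \<noteq> 0"
      using half_le_norm_add_1[OF v] by auto
    \<comment> \<open>For one nonzero base the principal power is additive in the exponent, and at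
      natural exponents it is the ordinary power.\<close>
    have "(1 + v) powr ?a = 1 / ((v + 1) powr of_real \<alpha> * (v + 1) ^ (j * k))"
      unfolding powr_minus powr_add using nz
      by (simp add: powr_nat' add.commute inverse_eq_divide del: of_nat_mult)
    then show "b * (?c * t) ^ k * ((1 + v) powr ?a / v ^ Suc (i * k)) =
        1 / (v * (v + 1) powr of_real \<alpha>) * (b * (?c * t / (v ^ i * (v + 1) ^ j)) ^ k)"
      using nz by (simp add: power_divide power_mult_distrib power_mult field_simps)
  qed
qed

section \<open>Termwise integration\<close>

lemma twisted_period_sums:
  assumes "0 < i" "0 < j" "0 < \<alpha>" and f: "has_abs_series \<omega> f (ball 0 1)"
    and t: "t \<in> ball 0 (1 / (2 ^ (i + j + 1) * \<bar>twist_const i j\<bar>))"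
  defines "s \<equiv> \<lambda>k. 2 * of_real pi * \<i> * (twist_coeff i j (of_real \<alpha>) k * fps_nth f k) * t ^ k"
  shows "twisted_integrand i j \<alpha> \<omega> t contour_integrable_on circlepath 0 (1/2)"
    and "summable (\<lambda>k. norm (s k))"
    and "s sums contour_integral (circlepath 0 (1/2)) (twisted_integrand i j \<alpha> \<omega> t)"
proof -
  define w where "w v = of_real (twist_const i j) * t / (v ^ i * (v + 1) ^ j)" for v
  define T where "T k v = 1 / (v * (v + 1) powr of_real \<alpha>) * (fps_nth f k * w v ^ k)" for k v
  \<comment> \<open>The majorant: the bound on the form times the absolute terms of the series of
    \<open>\<omega>\<close> at 1/2, inside its disc of convergence.\<close>
  define M where "M k = 2 * 2 powr \<alpha> * norm (fps_nth f k * (1/2) ^ k)" for k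
  have T: "(T k has_contour_integral s k) (circlepath 0 (1/2))" for k
    unfolding T_def w_def s_def by (rule has_contour_integral_twisted_term[OF assms(1-3)])
  have M: "summable M"
    unfolding M_def using f by (intro summable_mult) (simp add: has_abs_series_def)
  have w: "norm (w v) \<le> 1/2" if "norm v = 1/2" for v
    using norm_twist_arg_le[OF that assms(1,2) t] by (simp add: w_def)
  have TM: "norm (T k v) \<le> M k" if "norm v = 1/2" for k v
  proof -
    have "norm (w v) ^ k \<le> (1/2) ^ k"
      using w[OF that] by (intro power_mono) auto
    then show ?thesis
      unfolding T_def M_def norm_mult[of "1 / _"] using norm_twist_form_le[OF that assms(3)]
      by (intro mult_mono) (auto simp: norm_mult norm_power intro: mult_left_mono)
  qed
  \<comment> \<open>The bound on the integrand times the length of the circle.\<close>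
  have "norm (s k) \<le> M k * (2 * pi * (1/2))" for k
    by (rule has_contour_integral_bound_circlepath[OF T]) (simp add: M_def, simp_all add: TM)
  then show "summable (\<lambda>k. norm (s k))"
    by (intro summable_comparison_test[OF _ summable_mult2[OF M]]) auto
  have sum_T: "suminf (\<lambda>k. T k v) = twisted_integrand i j \<alpha> \<omega> t v" if "norm v = 1/2" for v
  proof -
    have "w v \<in> ball 0 1"
      using w[OF that] by simp
    then have "summable (\<lambda>k. norm (fps_nth f k * w v ^ k))"
      and "\<omega> (w v) = suminf (\<lambda>k. fps_nth f k * w v ^ k)"
      using f by (auto simp: has_abs_series_def eval_fps_def)
    then show ?thesis
      unfolding T_def twisted_integrand_def w_def[symmetric]
      by (simp only: suminf_mult summable_norm_cancel)
  qed
  have "uniform_limit (sphere 0 (1/2)) (\<lambda>n v. \<Sum>k<n. T k v) (\<lambda>v. suminf (\<lambda>k. T k v)) sequentially"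
    by (rule Weierstrass_m_test[OF _ M]) (simp add: TM)
  \<comment> \<open>The pointwise sum may be replaced by the integrand because the two agree on the
    circle.\<close>
  then have unif: "uniform_limit (sphere 0 (1/2)) (\<lambda>n v. \<Sum>k<n. T k v)
      (twisted_integrand i j \<alpha> \<omega> t) sequentially"
    by (rule uniform_limit_cong'[THEN iffD1, rotated -1]) (auto simp: sum_T)
  have partial: "((\<lambda>v. \<Sum>k<n. T k v) has_contour_integral (\<Sum>k<n. s k)) (circlepath 0 (1/2))" for n
    using T by (intro has_contour_integral_sum) auto
  \<comment> \<open>Uniform convergence on the circle gives both integrability of the limit and
    convergence of the integrals.\<close>
  note lim = contour_integral_uniform_limit_circlepath
    [OF always_eventually[OF allI[OF has_contour_integral_integrable[OF partial]]] unif]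
  show "twisted_integrand i j \<alpha> \<omega> t contour_integrable_on circlepath 0 (1/2)"
    using lim(1) by simp
  show "s sums contour_integral (circlepath 0 (1/2)) (twisted_integrand i j \<alpha> \<omega> t)"
    using lim(2) by (simp add: sums_def contour_integral_unique[OF partial])
qed

text \<open>Stated for any \<open>h\<close> with the right coefficients, so that it serves both
  shapes of the hypergeometric series.\<close>

lemma has_abs_series_twisted_period:
  assumes "0 < i" "0 < j" "0 < \<alpha>" "has_abs_series \<omega> f (ball 0 1)"
    and "\<And>k. fps_nth h k = twist_coeff i j (of_real \<alpha>) k"
  shows "has_abs_series
    (\<lambda>t. contour_integral (circlepath 0 (1/2)) (twisted_integrand i j \<alpha> \<omega> t))
    (fps_const (2 * of_real pi * \<i>) * (h \<star> f))
    (ball 0 (1 / (2 ^ (i + j + 1) * \<bar>twist_const i j\<bar>)))"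
  unfolding has_abs_series_def
proof (intro ballI conjI)
  fix t :: complex
  assume t: "t \<in> ball 0 (1 / (2 ^ (i + j + 1) * \<bar>twist_const i j\<bar>))"
  have coeff: "fps_nth (fps_const (2 * of_real pi * \<i>) * (h \<star> f)) k =
      2 * of_real pi * \<i> * (twist_coeff i j (of_real \<alpha>) k * fps_nth f k)" for k
    by (simp add: fps_hadamard_def assms(5))
  note sums = twisted_period_sums[OF assms(1-4) t]
  show "summable (\<lambda>k. norm (fps_nth (fps_const (2 * of_real pi * \<i>) * (h \<star> f)) k * t ^ k))"
    unfolding coeff by (rule sums(2))
  show "contour_integral (circlepath 0 (1/2)) (twisted_integrand i j \<alpha> \<omega> t) =
      eval_fps (fps_const (2 * of_real pi * \<i>) * (h \<star> f)) t"
    unfolding eval_fps_def coeff by (rule sums_unique[OF sums(3)])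
qed

theorem proposition5p1:
  fixes n i j :: nat and \<alpha> :: real
    and S :: "'s topology" and A :: "'s chart set" and c :: "'s chart"
    and g2 g3 :: wcoeff and \<omega> \<omega>' :: "complex \<Rightarrow> complex" and f :: "complex fps"
  defines "V \<equiv> snd c ` fst c"
  defines "D \<equiv> ball 0 (1 / (2 ^ (i + j + 1) * \<bar>twist_const i j\<bar>))"
  defines "\<omega>' \<equiv> \<lambda>t. contour_integral (circlepath 0 (1/2)) (twisted_integrand i j \<alpha> \<omega> t)"
  assumes "1 \<le> n"
    and "1 \<le> i" "i \<le> 6" "1 \<le> j" "j \<le> 6"
    and "\<alpha> \<in> {1/2, 1}"
    and "weierstrass_CY_family n S A c g2 g3"
    and "real (deg_t V g2) \<le> min (4 / real i) (4 * \<alpha> / real j)"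
    and "0 < deg_t V g3"
    and "real (deg_t V g3) \<le> min (6 / real i) (6 * \<alpha> / real j)"
    and "period_integral n V g2 g3 \<omega>"
    and "has_abs_series \<omega> f (ball 0 1)"
  shows "(\<forall>t\<in>D. twisted_integrand i j \<alpha> \<omega> t contour_integrable_on circlepath 0 (1/2)) \<and>
    (\<alpha> = 1 \<longrightarrow>
       has_abs_series \<omega>'
         (fps_const (2 * of_real pi * \<i>) *
           (fps_hypergeo
              (map (\<lambda>r. of_nat r / of_nat (i + j)) [1..<i + j])
              (map (\<lambda>r. of_nat r / of_nat i) [1..<i] @ map (\<lambda>r. of_nat r / of_nat j) [1..<j]) 1
            \<star> f)) D) \<and>
    (\<alpha> = 1/2 \<longrightarrow>
       has_abs_series \<omega>'
         (fps_const (2 * of_real pi * \<i>) *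
           (fps_hypergeo
              (map (\<lambda>r. (of_real \<alpha> + of_nat r) / of_nat (i + j)) [0..<i + j])
              (map (\<lambda>r. of_nat r / of_nat i) [1..<i] @
               map (\<lambda>r. (of_real \<alpha> + of_nat r) / of_nat j) [0..<j]) 1
            \<star> f)) D)"
proof -
  have pos: "0 < i" "0 < j" "0 < \<alpha>"
    using assms by auto
  note series = has_abs_series_twisted_period[OF pos \<open>has_abs_series \<omega> f (ball 0 1)\<close>]
  show ?thesis
    unfolding D_def \<omega>'_def
  proof (intro conjI ballI impI)
    fix t :: complex
    assume "t \<in> ball 0 (1 / (2 ^ (i + j + 1) * \<bar>twist_const i j\<bar>))"
    then show "twisted_integrand i j \<alpha> \<omega> t contour_integrable_on circlepath 0 (1/2)"
      by (rule twisted_period_sums(1)[OF pos \<open>has_abs_series \<omega> f (ball 0 1)\<close>])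
  \<comment> \<open>What remains is to match coefficients: the premise \<open>\<alpha> = 1\<close>
    leads to the shortened parameter lists, while \<alpha> = 1/2 keeps the full ones.\<close>
  qed (intro series, simp only: of_real_1 fps_hypergeo_nth_eq_twist_coeff_1
      fps_hypergeo_nth_eq_twist_coeff pos)+
qed

end
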